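(* Let $\mathbb{K}$ be a field of characteristic $0$, let $n\geq 1$, and let $\mathcal{D}_1$ be the $\mathbb{K}$-linear derivation of the polynomial algebra $\mathbb{K}[X,Y]=\mathbb{K}[x_1,\ldots,x_n,y_1,\ldots,y_n]$ in $2n$ variables defined by $$\mathcal{D}_1(x_i)=0,\qquad \mathcal{D}_1(y_i)=x_i,\qquad i=1,\ldots,n.$$ Then the algebra $S_1=\ker\mathcal{D}_1$ of joint semi-invariants of the $n$ linear binary forms $f_i=x_i\mathcal{X}+y_i\mathcal{Y}$, $i=1,\ldots,n$, is generated as a $\mathbb{K}$-algebra by the elements $x_1,x_2,\ldots,x_n$ and the determinants $$\begin{vmatrix} x_i & x_j\\ y_i & y_j\end{vmatrix},\qquad 1\leq i<j\leq n.$$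
   Context: For a derivation $\mathcal{D}$ of a $\mathbb{K}$-algebra $A$, $\ker\mathcal{D}=\{f\in A : \mathcal{D}(f)=0\}$, which is a $\mathbb{K}$-subalgebra of $A$. The algebra $S_1$ of joint semi-invariants of $n$ linear binary forms $f_i=x_i\mathcal{X}+y_i\mathcal{Y}$ (with $\mathcal{X},\mathcal{Y}$ the variables of the forms and $x_i,y_i$ their generic coefficients) is the subalgebra of $\mathbb{K}[X,Y]$ of polynomials in the coefficients invariant under the (Lie algebra of the) maximal unipotent subgroup of upper unitriangular matrices of $SL_2$; it is identified with $\ker\mathcal{D}_1$. *)

theory Defs
  imports "HOL-Analysis.Analysis" "HOL-Library.Poly_Mapping"
begin

datatype var = X nat | Y nat

text \<open>
  A polynomial is a finitely supported map from monomials to coefficients, and a monomial is a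
  finitely supported map from variables to exponents. The type has infinitely many variables;
  \<open>polys n\<close> is the polynomial ring in the \<open>2n\<close> variables indexed by \<open>1, \<dots>, n\<close>.
\<close>

type_synonym 'k mpoly = "(var \<Rightarrow>\<^sub>0 nat) \<Rightarrow>\<^sub>0 'k"

definition polys :: "nat \<Rightarrow> 'k::field mpoly set" where
  "polys n = {f. \<forall>m \<in> Poly_Mapping.keys f. Poly_Mapping.keys m \<subseteq> X ` {1..n} \<union> Y ` {1..n}}"

definition const :: "'k \<Rightarrow> 'k::field mpoly" where
  "const c = Poly_Mapping.single 0 c"

definition indet :: "var \<Rightarrow> 'k::field mpoly" where
  "indet v = Poly_Mapping.single (Poly_Mapping.single v 1) 1"

abbreviation xv :: "nat \<Rightarrow> 'k::field mpoly" where "xv i \<equiv> indet (X i)"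
abbreviation yv :: "nat \<Rightarrow> 'k::field mpoly" where "yv i \<equiv> indet (Y i)"

text \<open>Unital subalgebras over the coefficient field; scalar multiplication by \<open>c\<close> is
  multiplication by \<open>const c\<close>. The subalgebra generated by \<open>G\<close> is \<open>subalgebra hull G\<close>.\<close>

definition subalgebra :: "'k::field mpoly set \<Rightarrow> bool" where
  "subalgebra S \<longleftrightarrow> 1 \<in> S \<and> (\<forall>f\<in>S. \<forall>g\<in>S. f + g \<in> S \<and> f * g \<in> S) \<and>
     (\<forall>c. \<forall>f\<in>S. const c * f \<in> S)"

text \<open>Only the values of \<open>D\<close> on \<open>A\<close> matter.\<close>

definition derivation_on :: "'k::field mpoly set \<Rightarrow> ('k mpoly \<Rightarrow> 'k mpoly) \<Rightarrow> bool" where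
  "derivation_on A D \<longleftrightarrow> D ` A \<subseteq> A \<and>
     (\<forall>f\<in>A. \<forall>g\<in>A. D (f + g) = D f + D g) \<and>
     (\<forall>c. \<forall>f\<in>A. D (const c * f) = const c * D f) \<and>
     (\<forall>f\<in>A. \<forall>g\<in>A. D (f * g) = D f * g + f * D g)"

definition kernel_on :: "'k::field mpoly set \<Rightarrow> ('k mpoly \<Rightarrow> 'k mpoly) \<Rightarrow> 'k mpoly set" where
  "kernel_on A D = {f \<in> A. D f = 0}"

definition det2 :: "nat \<Rightarrow> nat \<Rightarrow> 'k::field mpoly" where
  "det2 i j = det (vector [vector [xv i, xv j], vector [yv i, yv j]] :: 'k mpoly ^ 2 ^ 2)"

lemma mpoly_sum_induct [case_names zero single add]:
  fixes f :: "'k::field mpoly"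
  assumes "P 0" "\<And>m c. m \<in> Poly_Mapping.keys f \<Longrightarrow> P (Poly_Mapping.single m c)"
    "\<And>g h. Poly_Mapping.keys g \<subseteq> Poly_Mapping.keys f \<Longrightarrow>
      Poly_Mapping.keys h \<subseteq> Poly_Mapping.keys f \<Longrightarrow> P g \<Longrightarrow> P h \<Longrightarrow> P (g + h)"
  shows "P f"
proof -
  let ?s = "\<lambda>F. \<Sum>m\<in>F. Poly_Mapping.single m (Poly_Mapping.lookup f m)"
  have keys: "Poly_Mapping.keys (?s F) \<subseteq> F" for F
    by (rule order_trans[OF keys_sum]) auto
  have *: "P (?s F)" if "finite F" "F \<subseteq> Poly_Mapping.keys f" for F
    using that
  proof (induction F rule: finite_induct)
    case empty
    then show ?case using assms(1) by simp
  next
    case (insert m F)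
    then have "P (Poly_Mapping.single m (Poly_Mapping.lookup f m) + ?s F)"
      using keys[of F] by (intro assms(3) assms(2)) auto
    then show ?case using insert by simp
  qed
  have "f = ?s (Poly_Mapping.keys f)"
    by (rule poly_mapping_eqI)
      (auto simp: lookup_sum lookup_single when_def in_keys_iff)
  then show ?thesis using *[of "Poly_Mapping.keys f"] by simp
qed

text \<open>The derivation with \<open>x\<^sub>i \<mapsto> 0\<close> and \<open>y\<^sub>i \<mapsto> x\<^sub>i\<close> exists: it is the sum of the
  \<open>x\<^sub>i \<partial>/\<partial>y\<^sub>i\<close>.\<close>

lemma derivation_exists:
  "\<exists>D :: 'k::field mpoly \<Rightarrow> 'k mpoly. derivation_on (polys n) D \<and>
     (\<forall>i\<in>{1..n}. D (xv i) = 0 \<and> D (yv i) = xv i)"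
proof -
  define e :: "(var \<Rightarrow>\<^sub>0 nat) \<Rightarrow> nat \<Rightarrow> (var \<Rightarrow>\<^sub>0 nat)" where
    "e m i = m - Poly_Mapping.single (Y i) 1 + Poly_Mapping.single (X i) 1" for m i
  define t :: "(var \<Rightarrow>\<^sub>0 nat) \<Rightarrow> nat \<Rightarrow> 'k mpoly" where
    "t m i = Poly_Mapping.single (e m i) (of_nat (Poly_Mapping.lookup m (Y i)))" for m i
  define d where "d m = (\<Sum>i\<in>{1..n}. t m i)" for m
  define D :: "'k mpoly \<Rightarrow> 'k mpoly" where
    "D f = (\<Sum>m\<in>Poly_Mapping.keys f. const (Poly_Mapping.lookup f m) * d m)" for f
  have c0: "const 0 = (0 :: 'k mpoly)" by (simp add: const_def)
  have c1: "const 1 = (1 :: 'k mpoly)" by (simp add: const_def)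
  have cadd: "const (a + b) = const a + (const b :: 'k mpoly)" for a b
    by (simp add: const_def single_add)
  have cmult: "const (a * b) = const a * (const b :: 'k mpoly)" for a b
    by (simp add: const_def mult_single)
  have Dadd: "D (f + g) = D f + D g" for f g
    unfolding D_def by (rule setsum_keys_plus_distrib) (simp_all add: c0 cadd distrib_right)
  have D0: "D 0 = 0" by (simp add: D_def)
  have Dsingle: "D (Poly_Mapping.single m c) = const c * d m" for m c
    by (cases "c = 0") (simp_all add: D_def c0)
  have split: "t (m + m') i = Poly_Mapping.single m 1 * t m' i + t m i * Poly_Mapping.single m' 1"
    for m m' i
  proof -
    have 1: "e (m + m') i = m + e m' i" if "Poly_Mapping.lookup m' (Y i) \<noteq> 0"
      using that unfolding e_def
      by (intro poly_mapping_eqI) (auto simp: lookup_add lookup_minus lookup_single when_def)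
    have 2: "e (m + m') i = e m i + m'" if "Poly_Mapping.lookup m (Y i) \<noteq> 0"
      using that unfolding e_def
      by (intro poly_mapping_eqI) (auto simp: lookup_add lookup_minus lookup_single when_def)
    show ?thesis
      using 1 2
      by (cases "Poly_Mapping.lookup m (Y i) = 0"; cases "Poly_Mapping.lookup m' (Y i) = 0")
        (simp_all add: t_def mult_single lookup_add single_add add.commute)
  qed
  have dmult: "d (m + m') = Poly_Mapping.single m 1 * d m' + d m * Poly_Mapping.single m' 1"
    for m m'
    unfolding d_def by (simp add: split sum.distrib sum_distrib_left sum_distrib_right)
  have csingle: "Poly_Mapping.single m c = const c * Poly_Mapping.single m 1"
    for m and c :: 'k
    by (simp add: const_def mult_single)
  have single_mult: "D (Poly_Mapping.single m a * Poly_Mapping.single m' b) =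
      D (Poly_Mapping.single m a) * Poly_Mapping.single m' b +
      Poly_Mapping.single m a * D (Poly_Mapping.single m' b)" for m m' a b
  proof -
    have "D (Poly_Mapping.single m a * Poly_Mapping.single m' b) = const (a * b) * d (m + m')"
      by (simp add: mult_single Dsingle)
    also have "\<dots> = const a * d m * (const b * Poly_Mapping.single m' 1) +
        const a * Poly_Mapping.single m 1 * (const b * d m')"
      by (simp add: dmult cmult algebra_simps)
    also have "\<dots> = D (Poly_Mapping.single m a) * Poly_Mapping.single m' b +
        Poly_Mapping.single m a * D (Poly_Mapping.single m' b)"
      by (simp only: Dsingle csingle[symmetric])
    finally show ?thesis .
  qed
  have Dmult1: "D (Poly_Mapping.single m a * g) =
      D (Poly_Mapping.single m a) * g + Poly_Mapping.single m a * D g" for m a g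
    by (induction g rule: mpoly_sum_induct)
      (simp_all add: D0 single_mult Dadd distrib_left add_ac)
  have Dmult: "D (f * g) = D f * g + f * D g" for f g
    by (induction f rule: mpoly_sum_induct)
      (simp_all add: D0 Dmult1 Dadd distrib_left distrib_right add_ac)
  have Dconst: "D (const c * f) = const c * D f" for c f
  proof -
    have "D (const c) = 0"
      unfolding const_def by (simp add: Dsingle d_def t_def)
    then show ?thesis by (simp add: Dmult)
  qed
  have Dpolys: "D f \<in> polys n" if f: "f \<in> polys n" for f
  proof -
    have "Poly_Mapping.keys k \<subseteq> X ` {1..n} \<union> Y ` {1..n}" if k: "k \<in> Poly_Mapping.keys (D f)" for k
    proof -
      obtain m where m: "m \<in> Poly_Mapping.keys f"
        and km: "k \<in> Poly_Mapping.keys (const (Poly_Mapping.lookup f m) * d m)"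
        using k keys_sum unfolding D_def by fastforce
      have "k \<in> Poly_Mapping.keys (d m)"
        using km keys_mult[of "const (Poly_Mapping.lookup f m)" "d m"]
        by (auto simp: const_def split: if_splits)
      then obtain i where i: "i \<in> {1..n}" "k \<in> Poly_Mapping.keys (t m i)"
        using keys_sum unfolding d_def by fastforce
      then have "k = e m i" by (auto simp: t_def split: if_splits)
      then have "Poly_Mapping.keys k \<subseteq> insert (X i) (Poly_Mapping.keys m)"
        unfolding e_def
        by (auto simp: in_keys_iff lookup_add lookup_minus lookup_single when_def split: if_splits)
      moreover have "Poly_Mapping.keys m \<subseteq> X ` {1..n} \<union> Y ` {1..n}"
        using f m unfolding polys_def by blast
      ultimately show ?thesis using i(1) by blast
    qed
    then show ?thesis unfolding polys_def by blast
  qed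
  have Dindet: "D (indet v) = d (Poly_Mapping.single v 1)" for v
    by (simp add: indet_def Dsingle c1)
  have "D (xv i) = 0" for i
    by (simp add: Dindet d_def t_def lookup_single)
  moreover have "D (yv i) = xv i" if "i \<in> {1..n}" for i
  proof -
    have "t (Poly_Mapping.single (Y i) 1) j = (if j = i then xv i else 0)" for j
      by (simp add: t_def e_def indet_def lookup_single)
    then show ?thesis using that by (simp add: Dindet d_def)
  qed
  ultimately show ?thesis
    using Dadd Dconst Dmult Dpolys by (intro exI[of _ D]) (auto simp: derivation_on_def)
qed

end

(*
  Let p and q be the total degrees in the x_i and in the y_i, let E = sum_j y_j d/dx_j, and let
  Omega_ij = d/dx_i d/dy_j - d/dx_j d/dy_i be Cayley's operators, which commute with D.
  Capelli's identity reads sum_{i<j} det_ij Omega_ij = (p + 1) q - E D, where p and q also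
  denote the Euler operators. On ker D the last term vanishes. Dividing each bihomogeneous component of
  positive y-degree by (p + 1) q therefore writes an element of ker D as a polynomial in the x_i
  plus a combination of the det_ij with coefficients in ker D of smaller y-degree.
*)
theory Submission
  imports Defs
begin

section \<open>Constants, and induction over monomials\<close>

lemma const_0 [simp]: "const 0 = (0 :: 'k::field mpoly)"
  by (simp add: const_def)

lemma const_1 [simp]: "const 1 = (1 :: 'k::field mpoly)"
  by (simp add: const_def)

lemma single_eq_const_mult:
  "Poly_Mapping.single m c = const c * (Poly_Mapping.single m 1 :: 'k::field mpoly)"
  by (simp add: const_def mult_single)

lemma single_sum: "Poly_Mapping.single m (sum f A) = (\<Sum>i\<in>A. Poly_Mapping.single m (f i))"
  by (induction A rule: infinite_finite_induct) (simp_all add: single_add)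

text \<open>Induction on the total degree: a nonzero monomial contains some variable, and dividing
  by it lowers the degree. It carries facts from variables to monomials.\<close>

lemma monomial_induct [consumes 1, case_names zero add]:
  fixes m :: "'v \<Rightarrow>\<^sub>0 nat"
  assumes "Poly_Mapping.keys m \<subseteq> V"
    and "P 0"
    and "\<And>m v. P m \<Longrightarrow> v \<in> V \<Longrightarrow> P (m + Poly_Mapping.single v 1)"
  shows "P m"
  using assms(1)
proof (induction "\<Sum>v\<in>Poly_Mapping.keys m. Poly_Mapping.lookup m v" arbitrary: m rule: less_induct)
  case less
  show ?case
  proof (cases "m = 0")
    case True
    then show ?thesis using assms(2) by simp
  next
    case False
    then obtain v where v: "v \<in> Poly_Mapping.keys m" by fastforce
    define m' where "m' = m - Poly_Mapping.single v 1"
    have m: "m = m' + Poly_Mapping.single v 1"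
      using v unfolding m'_def
      by (intro poly_mapping_eqI)
        (auto simp: lookup_add lookup_minus lookup_single when_def in_keys_iff)
    have sub: "Poly_Mapping.keys m' \<subseteq> Poly_Mapping.keys m"
      by (auto simp: m'_def in_keys_iff lookup_minus)
    have "(\<Sum>u\<in>Poly_Mapping.keys m'. Poly_Mapping.lookup m' u) =
        (\<Sum>u\<in>Poly_Mapping.keys m. Poly_Mapping.lookup m' u)"
      by (rule sum.mono_neutral_left) (use sub in \<open>auto simp: in_keys_iff\<close>)
    also have "\<dots> < (\<Sum>u\<in>Poly_Mapping.keys m. Poly_Mapping.lookup m u)"
    proof (rule sum_strict_mono_ex1)
      show "\<exists>u\<in>Poly_Mapping.keys m. Poly_Mapping.lookup m' u < Poly_Mapping.lookup m u"
        using v by (intro bexI[of _ v]) (auto simp: m'_def lookup_minus in_keys_iff)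
    qed (auto simp: m'_def lookup_minus)
    finally have "P m'" using less sub by blast
    then show ?thesis using assms(3)[of m' v] v less.prems m by auto
  qed
qed

lemma monomial_add_indet:
  "Poly_Mapping.single (m + Poly_Mapping.single v 1) 1 =
    (Poly_Mapping.single m 1 * indet v :: 'k::field mpoly)"
  by (simp add: indet_def mult_single)

section \<open>Partial derivatives\<close>

text \<open>The truncated exponent subtraction is harmless: where \<open>v\<close> does not occur in
  \<open>m\<close>, the coefficient is 0.\<close>

definition pd :: "var \<Rightarrow> 'k::field mpoly \<Rightarrow> 'k mpoly" where
  "pd v f = (\<Sum>m\<in>Poly_Mapping.keys f.
     Poly_Mapping.single (m - Poly_Mapping.single v 1)
       (of_nat (Poly_Mapping.lookup m v) * Poly_Mapping.lookup f m))"

lemma pd_add: "pd v (f + g) = pd v f + pd v g"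
  unfolding pd_def by (rule setsum_keys_plus_distrib) (simp_all add: distrib_left single_add)

lemma pd_0 [simp]: "pd v 0 = 0"
  by (simp add: pd_def)

lemma pd_single: "pd v (Poly_Mapping.single m c) =
    Poly_Mapping.single (m - Poly_Mapping.single v 1) (of_nat (Poly_Mapping.lookup m v) * c)"
  by (cases "c = 0") (simp_all add: pd_def)

lemma pd_1 [simp]: "pd v 1 = 0"
  using pd_single[of v 0 1] by simp

lemma pd_minus: "pd v (f - g) = pd v f - pd v g"
  by (metis pd_add add_diff_cancel diff_add_cancel)

lemma pd_sum: "pd v (sum f A) = (\<Sum>i\<in>A. pd v (f i))"
  by (induction A rule: infinite_finite_induct) (simp_all add: pd_add)

lemma pd_commute: "pd v (pd w f) = pd w (pd v f)"
proof (induction f rule: mpoly_sum_induct)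
  case (single m c)
  show ?case
    by (cases "v = w")
      (simp_all add: pd_single lookup_minus lookup_single diff_diff_add add.commute mult_ac)
qed (simp_all add: pd_add)

text \<open>The Leibniz rule with a single variable as one factor. This case suffices because the
  operators below are sums of terms of the form variable times derivative.\<close>

lemma pd_indet_mult: "pd v (indet w * f) = (if v = w then f else 0) + (indet w * pd v f)"
proof (induction f rule: mpoly_sum_induct)
  case (single m c)
  have "Poly_Mapping.single v 1 + m - Poly_Mapping.single v 1 = m"
    by simp
  \<comment> \<open>In the excluded case \<open>v = w\<close> with \<open>v\<close> absent from
    \<open>m\<close>, truncation breaks this equation of exponents, but there \<open>pd v\<close>
    kills the monomial.\<close>
  moreover have "Poly_Mapping.single w 1 + m - Poly_Mapping.single v 1 =
      Poly_Mapping.single w 1 + (m - Poly_Mapping.single v 1)"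
    if "v \<noteq> w \<or> Poly_Mapping.lookup m v \<noteq> 0"
    using that
    by (intro poly_mapping_eqI) (auto simp: lookup_add lookup_minus lookup_single when_def)
  ultimately show ?case
    by (cases "v = w"; cases "Poly_Mapping.lookup m v = 0")
      (simp_all add: indet_def mult_single pd_single lookup_add lookup_single
        distrib_right single_add)
qed (simp_all add: pd_add distrib_left)

lemma keys_pd:
  assumes "k \<in> Poly_Mapping.keys (pd v f)"
  obtains m where "m \<in> Poly_Mapping.keys f" "Poly_Mapping.lookup m v \<noteq> 0"
    "k = m - Poly_Mapping.single v 1"
proof -
  obtain m where "m \<in> Poly_Mapping.keys f"
    "k \<in> Poly_Mapping.keys (Poly_Mapping.single (m - Poly_Mapping.single v 1)
       (of_nat (Poly_Mapping.lookup m v) * Poly_Mapping.lookup f m))"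
    using assms keys_sum unfolding pd_def by fastforce
  then show ?thesis using that[of m] by (cases "Poly_Mapping.lookup m v = 0") (auto split: if_splits)
qed

section \<open>Polynomials in the first \<open>2n\<close> variables\<close>

lemma polys_add: "f \<in> polys n \<Longrightarrow> g \<in> polys n \<Longrightarrow> f + g \<in> polys n"
  using Poly_Mapping.keys_add[of f g] unfolding polys_def by blast

lemma polys_minus: "f \<in> polys n \<Longrightarrow> g \<in> polys n \<Longrightarrow> f - g \<in> polys n"
  using keys_diff[of f g] unfolding polys_def by blast

lemma polys_mult: "f \<in> polys n \<Longrightarrow> g \<in> polys n \<Longrightarrow> f * g \<in> polys n"
  unfolding polys_def
proof (intro CollectI ballI)
  fix m
  assume f: "f \<in> {f. \<forall>m\<in>Poly_Mapping.keys f. Poly_Mapping.keys m \<subseteq> X ` {1..n} \<union> Y ` {1..n}}"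
    and g: "g \<in> {f. \<forall>m\<in>Poly_Mapping.keys f. Poly_Mapping.keys m \<subseteq> X ` {1..n} \<union> Y ` {1..n}}"
    and "m \<in> Poly_Mapping.keys (f * g)"
  then obtain a b where "m = a + b" "a \<in> Poly_Mapping.keys f" "b \<in> Poly_Mapping.keys g"
    using keys_mult[of f g] by blast
  then show "Poly_Mapping.keys m \<subseteq> X ` {1..n} \<union> Y ` {1..n}"
    using f g Poly_Mapping.keys_add[of a b] by blast
qed

lemma polys_const [simp]: "const c \<in> polys n"
  by (auto simp: polys_def const_def)

lemma polys_1 [simp]: "1 \<in> polys n"
  using polys_const[of 1] by simp

lemma polys_xv [simp]: "i \<in> {1..n} \<Longrightarrow> xv i \<in> polys n"
  by (auto simp: polys_def indet_def)

lemma polys_yv [simp]: "i \<in> {1..n} \<Longrightarrow> yv i \<in> polys n"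
  by (auto simp: polys_def indet_def)

lemma polys_pd:
  assumes "f \<in> polys n"
  shows "pd v f \<in> polys n"
  unfolding polys_def
proof (intro CollectI ballI)
  fix k assume "k \<in> Poly_Mapping.keys (pd v f)"
  then obtain m where m: "m \<in> Poly_Mapping.keys f" "k = m - Poly_Mapping.single v 1"
    by (metis keys_pd)
  have "Poly_Mapping.keys k \<subseteq> Poly_Mapping.keys m"
    by (auto simp: m(2) in_keys_iff lookup_minus)
  then show "Poly_Mapping.keys k \<subseteq> X ` {1..n} \<union> Y ` {1..n}"
    using assms m(1) unfolding polys_def by blast
qed

lemma keys_monomial_polys: "f \<in> polys n \<Longrightarrow> m \<in> Poly_Mapping.keys f \<Longrightarrow>
    Poly_Mapping.keys m \<subseteq> X ` {1..n} \<union> Y ` {1..n}"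
  unfolding polys_def by blast

section \<open>The derivation and the Cayley operators\<close>

text \<open>The explicit model of the derivation, defined on all polynomials, so that the operator
  identities below need no membership in \<open>polys n\<close>.\<close>

definition Dx :: "nat \<Rightarrow> 'k::field mpoly \<Rightarrow> 'k mpoly" where
  "Dx n f = (\<Sum>i\<in>{1..n}. xv i * pd (Y i) f)"

definition Om :: "nat \<Rightarrow> nat \<Rightarrow> 'k::field mpoly \<Rightarrow> 'k mpoly" where
  "Om i j f = pd (X i) (pd (Y j) f) - pd (X j) (pd (Y i) f)"

lemma Dx_0 [simp]: "Dx n 0 = 0"
  by (simp add: Dx_def)

lemma Dx_1 [simp]: "Dx n 1 = 0"
  by (simp add: Dx_def)

lemma Dx_add: "Dx n (f + g) = Dx n f + Dx n g"
  by (simp add: Dx_def pd_add distrib_left sum.distrib)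

lemma Dx_minus: "Dx n (f - g) = Dx n f - Dx n g"
  by (simp add: Dx_def pd_minus right_diff_distrib sum_subtractf)

lemma Dx_pd_Y: "Dx n (pd (Y j) f) = pd (Y j) (Dx n f)"
  by (simp add: Dx_def pd_sum pd_indet_mult pd_commute[of "Y j"])

text \<open>The commutator of d/dx_j with D is d/dy_j, because x_j is the coefficient of d/dy_j in
  D; that term is present only for \<open>j\<close> in range.\<close>

lemma pd_X_Dx: "j \<in> {1..n} \<Longrightarrow> pd (X j) (Dx n f) = pd (Y j) f + Dx n (pd (X j) f)"
  by (simp add: Dx_def pd_sum pd_indet_mult sum.distrib pd_commute[of "X j"])

lemma Dx_pd_X: "j \<in> {1..n} \<Longrightarrow> Dx n (pd (X j) f) = pd (X j) (Dx n f) - pd (Y j) f"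
  by (simp add: pd_X_Dx)

text \<open>Each term of \<open>Om\<close> leaves a commutator correction; both equal the mixed
  derivative d/dy_i d/dy_j, and they cancel.\<close>

lemma Dx_Om:
  assumes "i \<in> {1..n}" "j \<in> {1..n}"
  shows "Dx n (Om i j f) = Om i j (Dx n f)"
  using assms by (simp add: Om_def Dx_minus Dx_pd_X Dx_pd_Y pd_commute[of "Y i" "Y j"])

lemma Dx_indet_mult:
  assumes "v \<in> X ` {1..n} \<union> Y ` {1..n}"
  shows "Dx n (indet v * f) = Dx n (indet v) * f + indet v * Dx n f"
proof -
  have 1: "Dx n (indet v * f) = (\<Sum>i\<in>{1..n}. xv i * (if Y i = v then f else 0)) + indet v * Dx n f"
    for f :: "'a mpoly"
    by (simp add: Dx_def pd_indet_mult distrib_left sum.distrib sum_distrib_left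
        mult.left_commute[of "indet v"])
  show ?thesis
    \<comment> \<open>The instance at 1 identifies the remaining sum as
      \<open>Dx n (indet v)\<close>.\<close>
    using 1[of f] 1[of 1]
    by (simp add: sum_distrib_right mult.assoc if_distrib[of "\<lambda>g. g * _"] cong: if_cong)
qed

text \<open>On the right, moving d/dx_j past D in the last sum yields the y-Euler term, which
  cancels the middle one. The surviving second-order terms, after one exchange of indices, form
  \<open>Om\<close>. The left side runs over ordered pairs with weight x_i y_j; antisymmetry of
  \<open>Om\<close> later turns these weights into determinants.\<close>

lemma Capelli:
  "(\<Sum>i\<in>{1..n}. \<Sum>j\<in>{1..n}. xv i * yv j * Om i j f) =
    (\<Sum>i\<in>{1..n}. xv i * pd (X i) (\<Sum>j\<in>{1..n}. yv j * pd (Y j) f)) +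
    (\<Sum>j\<in>{1..n}. yv j * pd (Y j) f) -
    (\<Sum>j\<in>{1..n}. yv j * pd (X j) (Dx n f))"
proof -
  have "(\<Sum>j\<in>{1..n}. yv j * pd (X j) (Dx n f)) = (\<Sum>j\<in>{1..n}. yv j * pd (Y j) f) +
     (\<Sum>j\<in>{1..n}. \<Sum>i\<in>{1..n}. xv i * yv j * pd (X j) (pd (Y i) f))"
    by (simp add: pd_X_Dx distrib_left sum.distrib)
       (simp add: Dx_def sum_distrib_left pd_commute[of "X _"] mult_ac)
  moreover have "(\<Sum>i\<in>{1..n}. xv i * pd (X i) (\<Sum>j\<in>{1..n}. yv j * pd (Y j) f)) =
     (\<Sum>i\<in>{1..n}. \<Sum>j\<in>{1..n}. xv i * yv j * pd (X i) (pd (Y j) f))"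
    by (simp add: pd_sum pd_indet_mult sum_distrib_left mult_ac)
  ultimately show ?thesis
    using sum.swap[of "\<lambda>i j. xv i * yv j * pd (X j) (pd (Y i) f)" "{1..n}" "{1..n}"]
    by (simp add: Om_def right_diff_distrib sum_subtractf)
qed

text \<open>A derivation is determined by its values on the variables: the Leibniz rule extends
  agreement to monomials, linearity to polynomials. Membership in \<open>polys n\<close> is carried
  along, since the laws of \<open>D\<close> are assumed only there.\<close>

lemma derivation_eq_Dx:
  fixes D :: "'k::field mpoly \<Rightarrow> 'k mpoly"
  assumes D: "derivation_on (polys n) D"
    and x: "\<And>i. i \<in> {1..n} \<Longrightarrow> D (xv i) = 0"
    and y: "\<And>i. i \<in> {1..n} \<Longrightarrow> D (yv i) = xv i"
    and f: "f \<in> polys n"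
  shows "D f = Dx n f"
proof -
  let ?V = "X ` {1..n} \<union> Y ` {1..n}"
  have add: "D (f + g) = D f + D g" if "f \<in> polys n" "g \<in> polys n" for f g
    using D that unfolding derivation_on_def by blast
  have scal: "D (const c * f) = const c * D f" if "f \<in> polys n" for f c
    using D that unfolding derivation_on_def by blast
  have mult: "D (f * g) = D f * g + f * D g" if "f \<in> polys n" "g \<in> polys n" for f g
    using D that unfolding derivation_on_def by blast
  have D1: "D 1 = 0" using mult[of 1 1] by simp
  have ind: "indet v \<in> polys n" "D (indet v) = Dx n (indet v)" if "v \<in> ?V" for v
  proof -
    show "indet v \<in> polys n" using that by auto
    have "pd w (indet v) = (if w = v then 1 else 0 :: 'k mpoly)" for w
      using pd_indet_mult[of w v "1 :: 'k mpoly"] by simp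
    then show "D (indet v) = Dx n (indet v)"
      using that x y by (auto simp: Dx_def if_distrib[of "\<lambda>g. _ * g"] sum.delta' cong: if_cong)
  qed
  have mono: "Poly_Mapping.single m (1 :: 'k) \<in> polys n \<and>
      D (Poly_Mapping.single m 1) = Dx n (Poly_Mapping.single m 1)"
    if "Poly_Mapping.keys m \<subseteq> ?V" for m
    using that
  proof (induction rule: monomial_induct)
    case zero
    then show ?case using D1 by simp
  next
    case (add m v)
    have m: "Poly_Mapping.single m (1 :: 'k) \<in> polys n"
        "D (Poly_Mapping.single m 1) = Dx n (Poly_Mapping.single m 1)"
      using add by blast+
    have "D (indet v * Poly_Mapping.single m 1) = Dx n (indet v * Poly_Mapping.single m 1)"
      unfolding mult[OF ind(1)[OF add(2)] m(1)] Dx_indet_mult[OF add(2)] ind(2)[OF add(2)] m(2) ..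
    then show ?case
      unfolding monomial_add_indet
      using polys_mult[OF ind(1)[OF add(2)] m(1)] by (simp add: mult.commute)
  qed
  have D0: "D 0 = 0" using scal[of 1 0] by simp
  have "f \<in> polys n \<and> D f = Dx n f"
  proof (induction f rule: mpoly_sum_induct)
    case zero
    then show ?case using D0 by (simp add: polys_def)
  next
    case (single m c)
    have "Dx n (const c * g) = const c * Dx n g" for g :: "'k mpoly"
    proof (induction g rule: mpoly_sum_induct)
      case (single m b)
      then show ?case
        by (simp add: Dx_def sum_distrib_left const_def mult_single pd_single indet_def mult_ac)
    qed (simp_all add: Dx_add distrib_left)
    then show ?case
      using mono[OF keys_monomial_polys[OF f single]]
      by (subst (1 2 3) single_eq_const_mult) (simp add: scal polys_mult)
  qed (simp add: polys_add Dx_add add)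
  then show ?thesis ..
qed

section \<open>Bidegrees\<close>

definition xdeg :: "nat \<Rightarrow> (var \<Rightarrow>\<^sub>0 nat) \<Rightarrow> nat" where
  "xdeg n m = (\<Sum>i\<in>{1..n}. Poly_Mapping.lookup m (X i))"

definition ydeg :: "nat \<Rightarrow> (var \<Rightarrow>\<^sub>0 nat) \<Rightarrow> nat" where
  "ydeg n m = (\<Sum>i\<in>{1..n}. Poly_Mapping.lookup m (Y i))"

text \<open>An operator diagonal in the monomial basis. The Euler operators, division by (p + 1) q
  and projection to y-degree 0 are all of this kind.\<close>

definition rescale :: "((var \<Rightarrow>\<^sub>0 nat) \<Rightarrow> 'k) \<Rightarrow> 'k::field mpoly \<Rightarrow> 'k mpoly" where
  "rescale c = Poly_Mapping.mapp (\<lambda>m a. c m * a)"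

lemma lookup_rescale: "Poly_Mapping.lookup (rescale c f) m = c m * Poly_Mapping.lookup f m"
  by (simp add: rescale_def mapp.rep_eq when_def in_keys_iff)

lemma rescale_0 [simp]: "rescale c 0 = 0"
  by (rule poly_mapping_eqI) (simp add: lookup_rescale)

lemma rescale_add: "rescale c (f + g) = rescale c f + rescale c g"
  by (rule poly_mapping_eqI) (simp add: lookup_rescale lookup_add distrib_left)

lemma rescale_sum: "rescale c (sum f A) = (\<Sum>i\<in>A. rescale c (f i))"
  by (induction A rule: infinite_finite_induct) (simp_all add: rescale_add)

lemma rescale_single: "rescale c (Poly_Mapping.single m a) = Poly_Mapping.single m (c m * a)"
  by (rule poly_mapping_eqI) (simp add: lookup_rescale lookup_single when_def)

lemma keys_rescale: "Poly_Mapping.keys (rescale c f) \<subseteq> Poly_Mapping.keys f"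
  by (auto simp: in_keys_iff lookup_rescale)

lemma polys_rescale: "f \<in> polys n \<Longrightarrow> rescale c f \<in> polys n"
  using keys_rescale[of c f] unfolding polys_def by blast

lemma indet_mult_pd_single:
  "indet w * pd v (Poly_Mapping.single m c) =
    Poly_Mapping.single (m - Poly_Mapping.single v 1 + Poly_Mapping.single w 1)
      (of_nat (Poly_Mapping.lookup m v) * c)"
  by (simp add: pd_single indet_def mult_single add.commute)

lemma indet_mult_pd_same_single:
  "indet v * pd v (Poly_Mapping.single m c) =
    Poly_Mapping.single m (of_nat (Poly_Mapping.lookup m v) * c)"
proof (cases "Poly_Mapping.lookup m v = 0")
  case False
  then have "m - Poly_Mapping.single v 1 + Poly_Mapping.single v 1 = m"
    by (intro poly_mapping_eqI) (auto simp: lookup_add lookup_minus lookup_single when_def)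
  then show ?thesis by (simp add: indet_mult_pd_single)
qed (simp add: indet_mult_pd_single)

text \<open>Monomials are eigenvectors of the Euler operators, so Capelli's identity can be read off
  coefficient by coefficient.\<close>

lemma Euler_x: "(\<Sum>i\<in>{1..n}. xv i * pd (X i) f) = rescale (\<lambda>m. of_nat (xdeg n m)) f"
proof (induction f rule: mpoly_sum_induct)
  case (single m c)
  show ?case
    by (simp add: indet_mult_pd_same_single rescale_single xdeg_def sum_distrib_right single_sum)
qed (simp_all add: pd_add distrib_left sum.distrib rescale_add)

lemma Euler_y: "(\<Sum>i\<in>{1..n}. yv i * pd (Y i) f) = rescale (\<lambda>m. of_nat (ydeg n m)) f"
proof (induction f rule: mpoly_sum_induct)
  case (single m c)
  show ?case
    by (simp add: indet_mult_pd_same_single rescale_single ydeg_def sum_distrib_right single_sum)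
qed (simp_all add: pd_add distrib_left sum.distrib rescale_add)

text \<open>\<open>D\<close> shifts the bidegree by \<open>(1, -1)\<close>. The truncated subtraction is harmless, since every
  monomial of \<open>Dx n f\<close> has positive \<open>x\<close>-degree.\<close>

lemma Dx_rescale:
  fixes a :: "nat \<Rightarrow> nat \<Rightarrow> 'k::field"
  shows "Dx n (rescale (\<lambda>m. a (xdeg n m) (ydeg n m)) f) =
    rescale (\<lambda>m. a (xdeg n m - 1) (ydeg n m + 1)) (Dx n f)"
proof (induction f rule: mpoly_sum_induct)
  case (single m c)
  have "xv i * pd (Y i) (Poly_Mapping.single m (a (xdeg n m) (ydeg n m) * c)) =
      rescale (\<lambda>m. a (xdeg n m - 1) (ydeg n m + 1)) (xv i * pd (Y i) (Poly_Mapping.single m c))"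
    if i: "i \<in> {1..n}" for i
  proof (cases "Poly_Mapping.lookup m (Y i) = 0")
    case False
    let ?m = "m - Poly_Mapping.single (Y i) 1 + Poly_Mapping.single (X i) 1"
    have "xdeg n ?m = (\<Sum>k\<in>{1..n}. Poly_Mapping.lookup m (X k) + (if k = i then 1 else 0))"
      unfolding xdeg_def
      by (rule sum.cong) (auto simp: lookup_add lookup_minus lookup_single when_def)
    then have x: "xdeg n ?m = xdeg n m + 1"
      using i by (simp add: sum.distrib xdeg_def)
    have "ydeg n m = (\<Sum>k\<in>{1..n}. Poly_Mapping.lookup ?m (Y k) + (if k = i then 1 else 0))"
      unfolding ydeg_def
      by (rule sum.cong) (use False in \<open>auto simp: lookup_add lookup_minus lookup_single when_def\<close>)
    then have y: "ydeg n m = ydeg n ?m + 1"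
      using i by (simp add: sum.distrib ydeg_def)
    show ?thesis
      using x y by (simp add: indet_mult_pd_single rescale_single mult_ac)
  qed (simp add: pd_single)
  then show ?case
    by (simp add: rescale_single Dx_def rescale_sum)
qed (simp_all add: Dx_add rescale_add)

lemma ydeg_Om:
  assumes ij: "i \<in> {1..n}" "j \<in> {1..n}"
    and k: "\<And>m. m \<in> Poly_Mapping.keys f \<Longrightarrow> ydeg n m \<le> Suc k"
    and m: "m \<in> Poly_Mapping.keys (Om i j f)"
  shows "ydeg n m \<le> k"
proof -
  \<comment> \<open>The indices are generalized because the two terms of \<open>Om\<close> differ by
    exchanging \<open>i\<close> and \<open>j\<close>.\<close>
  have *: "ydeg n m \<le> k"
    if m: "m \<in> Poly_Mapping.keys (pd (X i) (pd (Y j) f))" and j: "j \<in> {1..n}" for i j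
  proof -
    obtain m' where m': "m' \<in> Poly_Mapping.keys f" "Poly_Mapping.lookup m' (Y j) \<noteq> 0"
      "m = m' - Poly_Mapping.single (Y j) 1 - Poly_Mapping.single (X i) 1"
    proof -
      obtain m'' where "m'' \<in> Poly_Mapping.keys (pd (Y j) f)"
        "m = m'' - Poly_Mapping.single (X i) 1"
        using keys_pd[OF m] by metis
      then show ?thesis using that by (metis keys_pd)
    qed
    have "ydeg n m < ydeg n m'"
      unfolding ydeg_def
    \<comment> \<open>No exponent grows, and that of \<open>Y j\<close>, which is positive in
      \<open>m'\<close>, strictly drops.\<close>
    proof (rule sum_strict_mono_ex1)
      show "\<exists>k\<in>{1..n}. Poly_Mapping.lookup m (Y k) < Poly_Mapping.lookup m' (Y k)"
        using m' j by (intro bexI[of _ j]) (auto simp: lookup_minus lookup_single)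
    qed (auto simp: m' lookup_minus)
    then show ?thesis using k[OF m'(1)] by simp
  qed
  show ?thesis
    using keys_diff[THEN subsetD, OF m[unfolded Om_def]] * ij by blast
qed

section \<open>Subalgebras\<close>

lemma subalgebra_hull: "subalgebra (subalgebra hull G)"
  by (rule hull_in) (auto simp: subalgebra_def)

lemma subalgebra_0: "subalgebra S \<Longrightarrow> 0 \<in> S"
  unfolding subalgebra_def by (metis const_0 mult_zero_left)

lemma subalgebra_sum:
  "subalgebra S \<Longrightarrow> (\<And>i. i \<in> A \<Longrightarrow> f i \<in> S) \<Longrightarrow> sum f A \<in> S"
  by (induction A rule: infinite_finite_induct) (auto simp: subalgebra_0 subalgebra_def)

section \<open>Membership in a subalgebra containing the generators\<close>

lemma det2_eq: "det2 i j = xv i * yv j - xv j * yv i"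
  by (simp add: det2_def det_2)

text \<open>Passes from pairs i < j to all ordered pairs, over which the Capelli sum runs: the
  diagonal determinants vanish and reversed ones change sign.\<close>

lemma det2_in_subalgebra:
  assumes S: "subalgebra S"
    and det: "\<And>i j. 1 \<le> i \<Longrightarrow> i < j \<Longrightarrow> j \<le> n \<Longrightarrow> det2 i j \<in> S"
    and ij: "i \<in> {1..n}" "j \<in> {1..n}"
  shows "det2 i j \<in> S"
proof (cases i j rule: linorder_cases)
  case equal
  then show ?thesis using subalgebra_0[OF S] by (simp add: det2_eq)
next
  case greater
  have "const (-1) * det2 j i = (det2 i j :: 'a mpoly)"
    by (simp add: det2_eq const_def single_uminus single_one)
  then show ?thesis
    using S det[of j i] greater ij unfolding subalgebra_def by (metis atLeastAtMost_iff)
qed (use det ij in auto)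

text \<open>The base of the descent: in \<open>polys n\<close>, y-degree 0 leaves only the variables
  x_i.\<close>

lemma ydeg_0_in_subalgebra:
  assumes S: "subalgebra S"
    and x: "\<And>i. i \<in> {1..n} \<Longrightarrow> xv i \<in> S"
    and f: "f \<in> polys n" "\<And>m. m \<in> Poly_Mapping.keys f \<Longrightarrow> ydeg n m = 0"
  shows "f \<in> S"
proof (induction f rule: mpoly_sum_induct)
  case zero
  then show ?case by (rule subalgebra_0[OF S])
next
  case (single m c)
  have "Poly_Mapping.keys m \<subseteq> X ` {1..n}"
    using keys_monomial_polys[OF f(1) single] f(2)[OF single] by (auto simp: ydeg_def in_keys_iff)
  then have "Poly_Mapping.single m 1 \<in> S"
  proof (induction rule: monomial_induct)
    case zero
    then show ?case using S by (simp add: subalgebra_def)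
  next
    case (add m v)
    then show ?case
      unfolding monomial_add_indet using S x unfolding subalgebra_def by blast
  qed
  then show ?case
    using S by (subst single_eq_const_mult) (simp add: subalgebra_def)
qed (use S in \<open>simp add: subalgebra_def\<close>)

text \<open>Induction on a bound for the y-degree, which each \<open>Om i j\<close> lowers while
  preserving the kernel. Rescaling treats all bidegrees at once, without splitting \<open>f\<close>
  into components.\<close>

lemma Dx_kernel_in_subalgebra:
  fixes S :: "'k::field_char_0 mpoly set"
  assumes S: "subalgebra S"
    and x: "\<And>i. i \<in> {1..n} \<Longrightarrow> xv i \<in> S"
    and det: "\<And>i j. 1 \<le> i \<Longrightarrow> i < j \<Longrightarrow> j \<le> n \<Longrightarrow> det2 i j \<in> S"
    and f: "f \<in> polys n" "Dx n f = 0" "\<And>m. m \<in> Poly_Mapping.keys f \<Longrightarrow> ydeg n m \<le> k"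
  shows "f \<in> S"
  using f
proof (induction k arbitrary: f)
  case 0
  then show ?case using ydeg_0_in_subalgebra[OF S x, of n f] by simp
next
  case (Suc k)
  \<comment> \<open>This is 1 / ((p + 1) q), with value \<open>inverse 0 = 0\<close> at q = 0; hence
    \<open>g\<close> has no monomials of y-degree 0. That part of \<open>f\<close> is kept in
    \<open>f0\<close>.\<close>
  define a :: "nat \<Rightarrow> nat \<Rightarrow> 'k" where "a p q = inverse (of_nat (p * q + q))" for p q
  define g where "g = rescale (\<lambda>m. a (xdeg n m) (ydeg n m)) f"
  define f0 where "f0 = rescale (\<lambda>m. if ydeg n m = 0 then 1 else 0) f"
  let ?Om = "\<Sum>i\<in>{1..n}. \<Sum>j\<in>{1..n}. xv i * yv j * Om i j g"
  \<comment> \<open>The weights depend only on the bidegree, which D shifts uniformly, so rescaling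
    preserves the kernel.\<close>
  have Dg: "Dx n g = 0" unfolding g_def by (simp add: Dx_rescale Suc.prems)
  have Om: "Om i j g \<in> S" if ij: "i \<in> {1..n}" "j \<in> {1..n}" for i j
  proof (rule Suc.IH)
    show "Om i j g \<in> polys n"
      unfolding Om_def g_def by (intro polys_minus polys_pd polys_rescale Suc.prems)
    show "Dx n (Om i j g) = 0"
      using ij by (simp add: Dx_Om Dg) (simp add: Om_def)
    show "ydeg n m \<le> k" if "m \<in> Poly_Mapping.keys (Om i j g)" for m
      using ydeg_Om[OF ij _ that] keys_rescale Suc.prems(3) unfolding g_def by blast
  qed
  have f0: "f0 \<in> S"
  proof (rule ydeg_0_in_subalgebra[OF S x])
    show "f0 \<in> polys n" unfolding f0_def by (intro polys_rescale Suc.prems)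
    show "ydeg n m = 0" if "m \<in> Poly_Mapping.keys f0" for m
      using that by (auto simp: f0_def in_keys_iff lookup_rescale split: if_splits)
  qed
  \<comment> \<open>The Capelli multiplier in the nested form in which the coefficients appear;
    characteristic 0 makes (p + 1) q invertible.\<close>
  have inv: "of_nat p * (of_nat q * (a p q * c)) + of_nat q * (a p q * c) = c" if "q \<noteq> 0" for p q c
  proof -
    have "of_nat (p * q + q) * a p q = 1"
      unfolding a_def using that by (intro right_inverse) (simp only: of_nat_eq_0_iff)
    then have "(of_nat p * of_nat q + of_nat q) * a p q * c = c" by simp
    then show ?thesis by (simp add: algebra_simps)
  qed
  have "?Om = rescale (\<lambda>m. of_nat (xdeg n m)) (rescale (\<lambda>m. of_nat (ydeg n m)) g) +
      rescale (\<lambda>m. of_nat (ydeg n m)) g"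
    unfolding Capelli Dg Euler_x Euler_y by simp
  \<comment> \<open>Coefficients of y-degree 0 come from \<open>f0\<close> alone, all others from
    \<open>?Om\<close> by \<open>inv\<close>.\<close>
  then have f: "f = f0 + ?Om"
    by (intro poly_mapping_eqI)
      (simp add: lookup_rescale lookup_add g_def f0_def inv)
  have neg: "xv j * yv i * Om j i g = - (xv j * yv i * Om i j g)" for i j
    unfolding Om_def by (simp add: right_diff_distrib)
  have "?Om = (\<Sum>i\<in>{1..n}. \<Sum>j\<in>{1..n}. xv j * yv i * Om j i g)"
    by (rule sum.swap)
  also have "\<dots> = - (\<Sum>i\<in>{1..n}. \<Sum>j\<in>{1..n}. xv j * yv i * Om i j g)"
    by (simp only: neg sum_negf)
  finally have swap: "?Om = \<dots>" .
  \<comment> \<open>Averaging \<open>?Om\<close> with its index-swapped form produces the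
    determinants. Each unordered pair is then counted twice, whence the factor 1/2 below.\<close>
  have "?Om + ?Om = ?Om - (\<Sum>i\<in>{1..n}. \<Sum>j\<in>{1..n}. xv j * yv i * Om i j g)"
    using arg_cong[OF swap, of "\<lambda>h. ?Om + h"] by (simp only: add_uminus_conv_diff)
  also have "\<dots> = (\<Sum>i\<in>{1..n}. \<Sum>j\<in>{1..n}. det2 i j * Om i j g)"
    by (simp only: det2_eq left_diff_distrib sum_subtractf)
  also have "\<dots> \<in> S"
    using S Om det2_in_subalgebra[OF S det] by (intro subalgebra_sum) (auto simp: subalgebra_def)
  finally have "const (1/2) * (?Om + ?Om) \<in> S"
    using S unfolding subalgebra_def by blast
  moreover have "const (1/2) * (h + h) = h" for h :: "'k mpoly"
  proof -
    have "const (1/2) * (h + h) = (const (1/2) + const (1/2)) * h"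
      by (simp add: algebra_simps)
    also have "const (1/2) + const (1/2) = (1 :: 'k mpoly)"
      by (simp add: const_def flip: single_add)
    finally show ?thesis by simp
  qed
  ultimately have "?Om \<in> S" by simp
  then have "f0 + ?Om \<in> S" using S f0 unfolding subalgebra_def by blast
  then show ?case unfolding f[symmetric] .
qed

section \<open>The kernel and its generators\<close>

lemma subalgebra_kernel:
  assumes "derivation_on (polys n) D"
  shows "subalgebra (kernel_on (polys n) D)"
proof -
  have "D (1 * 1) = D 1 * 1 + 1 * D 1"
    using assms polys_1 unfolding derivation_on_def by blast
  then have "D 1 = 0" by simp
  then show ?thesis
    using assms unfolding subalgebra_def kernel_on_def derivation_on_def
    by (auto simp: polys_add polys_mult)
qed

theorem theorem3:
  fixes n :: nat and D\<^sub>1 :: "'k::field_char_0 mpoly \<Rightarrow> 'k mpoly"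
  assumes "n \<ge> 1"
    and "derivation_on (polys n) D\<^sub>1"
    and "\<And>i. i \<in> {1..n} \<Longrightarrow> D\<^sub>1 (xv i) = 0"
    and "\<And>i. i \<in> {1..n} \<Longrightarrow> D\<^sub>1 (yv i) = xv i"
  shows "kernel_on (polys n) D\<^sub>1 =
    subalgebra hull ({xv i | i. i \<in> {1..n}} \<union> {det2 i j | i j. 1 \<le> i \<and> i < j \<and> j \<le> n})"
    (is "?K = subalgebra hull ?G")
proof
  have D: "D\<^sub>1 f = Dx n f" if "f \<in> polys n" for f
    using derivation_eq_Dx[OF assms(2-4) that] .
  have "det2 i j \<in> ?K" if "1 \<le> i" "i < j" "j \<le> n" for i j
  proof -
    have ij: "i \<in> {1..n}" "j \<in> {1..n}" using that by auto
    then have p: "det2 i j \<in> polys n"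
      unfolding det2_eq by (intro polys_minus polys_mult) auto
    have "D\<^sub>1 (xv i * yv j) = xv i * xv j" if "i \<in> {1..n}" "j \<in> {1..n}" for i j
    proof -
      have "D\<^sub>1 (xv i * yv j) = D\<^sub>1 (xv i) * yv j + xv i * D\<^sub>1 (yv j)"
        using assms(2) polys_xv[OF that(1)] polys_yv[OF that(2)] unfolding derivation_on_def by blast
      then show ?thesis using assms(3,4) that by simp
    qed
    \<comment> \<open>\<open>derivation_on\<close> speaks only of sums, so the difference is handled
      through \<open>Dx\<close>. The two products have the same image x_i x_j, and the determinant
      is killed.\<close>
    moreover have "D\<^sub>1 (det2 i j) = D\<^sub>1 (xv i * yv j) - D\<^sub>1 (xv j * yv i)"
      using ij by (simp add: D p polys_mult) (simp add: det2_eq Dx_minus)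
    ultimately show ?thesis using ij p by (simp add: kernel_on_def)
  qed
  then show "subalgebra hull ?G \<subseteq> ?K"
    using subalgebra_kernel[OF assms(2)] assms(3)
    by (intro hull_minimal) (auto simp: kernel_on_def)
  show "?K \<subseteq> subalgebra hull ?G"
  proof
    fix f assume "f \<in> ?K"
    then have f: "f \<in> polys n" "Dx n f = 0" using D by (auto simp: kernel_on_def)
    show "f \<in> subalgebra hull ?G"
    proof (rule Dx_kernel_in_subalgebra[OF subalgebra_hull _ _ f])
      \<comment> \<open>A polynomial has finitely many monomials, so the maximum is a bound; for
        \<open>f = 0\<close> there is no \<open>m\<close> to check.\<close>
      show "ydeg n m \<le> Max (ydeg n ` Poly_Mapping.keys f)" if "m \<in> Poly_Mapping.keys f" for m
        using that by simp
    qed (auto intro!: hull_inc)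
  qed
qed

end
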